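(* Let $N\ge 1$. With $\mathfrak S_N$, the set of germs $\mathfrak S_N^{\mathbb C}$ and the recipe $\mathsf R$ defined in the context, the set $\mathsf R(\mathfrak S_N^{\mathbb C})$ is a complete set of rank-$N$ charge-conserving braid representations up to X-equivalence. That is: (i) for every germ $g\in\mathfrak S_N^{\mathbb C}$ the operator $\mathsf R(g)$ is a rank-$N$ charge-conserving braid representation; and (ii) every rank-$N$ charge-conserving braid representation is X-equivalent to $\mathsf R(g)$ for some germ $g\in\mathfrak S_N^{\mathbb C}$.
   Context: Let $V=\mathbb C^N$ with standard basis $e_1,\dots,e_N$ and write $|ij\rangle=e_i\otimes e_j$. A linear operator $R$ on $V\otimes V$ is charge-conserving if there are scalars with $R|ii\rangle=a_i|ii\rangle$ for all $i$, and for all $i<j$: $R|ij\rangle=a_{ij}|ij\rangle+b_{ij}|ji\rangle$, $R|ji\rangle=c_{ij}|ij\rangle+d_{ij}|ji\rangle$. Write $A(i,j)=\begin{pmatrix}a_{ij}&b_{ij}\\c_{ij}&d_{ij}\end{pmatrix}$ for $i<j$; so $R$ is determined by the $a_i$ and the $A(i,j)$. A rank-$N$ charge-conserving braid representation is an invertible charge-conserving $R$ with $(R\otimes 1_V)(1_V\otimes R)(R\otimes 1_V)=(1_V\otimes R)(R\otimes 1_V)(1_V\otimes R)$ (equivalently, a strict monoidal functor $F$ from the braid category to the category of charge-conserving matrices with $F(1)=1$, where $R=F(\sigma)$ is the image of the elementary braid). X-equivalence: $R$ and $R'$ are X-equivalent if $R'=XRX^{-1}$ for some invertible operator $X$ on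 $V\otimes V$ that is diagonal in the basis $(|ij\rangle)$. $\mathfrak S_N$ is the set of quadruples $(p,q,\rho,s)$ where: $p$ is a set partition of $\{1,\dots,N\}$ (its parts are called nations); $q$ is a refinement of $p$ (its parts are called counties; each nation is a union of counties); $\rho$ is a choice, for each nation, of a total order on the counties in that nation; $s$ is a choice, for each nation, of a set partition of the set of its counties into at most two parts. A germ is a pair consisting of $(p,q,\rho,s)\in\mathfrak S_N$ and a choice of: a nonzero complex number $\alpha_n$ for each nation $n$; for each nation $n$ with more than one county, a nonzero complex number $\beta_n$ with $\alpha_n+\beta_n\ne0$; and a nonzero complex number $\mu_{n,n'}=\mu_{n',n}$ for each pair of distinct nations $n,n'$. $\mathfrak S^{\mathbb C}_N$ is the set of germs. The recipe $\mathsf R$ sends a germ to the charge-conserving operator given by: (i) if $i<j$ lie in different nations $n,n'$, then $A(i,j)=\begin{pmatrix}0&\mu_{n,n'}\\ \mu_{n,n'}&0\end{pmatrix}$; (ii) for a vertex $i$ in nation $n$: $a_i=\alpha_n$ if the county of $i$ lies in the same part of $s$ as the $\rho$-first county of $n$, and $a_i=\beta_n$ otherwise; (iii) if $i<j$ lie in the same county then $A(i,j)=a_i\begin{pmatrix}1&0\\0&1\end{pmatrix}$ (note $a_i=a_j$); (iv) if $i<j$ lie in the same nation $n$ but different counties, then $A(i,j)=\begin{pmatrix}\alpha_n+\beta_n&1\\-\alpha_n\beta_n&0\end{pmatrix}$ if the county of $i$ precedes the county of $j$ in the order $\rho$, and $A(i,j)=\begin{pmatrix}0&1\\-\alpha_n\beta_n&\alpha_n+\beta_n\end{pmatrix}$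 otherwise. *)

theory Defs
  imports "HOL-Analysis.Analysis" "HOL-Library.Disjoint_Sets"
begin

text \<open>
  The ordered index set \<open>{1, \<dots>, N}\<close> is an arbitrary nonempty finite linearly ordered type
  \<open>'n\<close> with \<open>N = CARD('n)\<close>, so \<open>V\<close> is \<open>complex ^ 'n\<close> and the tensor square and cube of \<open>V\<close> have
  coordinates indexed by \<open>'n \<times> 'n\<close> and \<open>'n \<times> 'n \<times> 'n\<close>. Operators are identified with their
  matrices with respect to the standard basis: the column with index \<open>(k, l)\<close> is the image of the
  basis vector with that index.
\<close>

type_synonym 'n operator = "complex ^ ('n \<times> 'n) ^ ('n \<times> 'n)"

definition ket :: "'n::finite \<Rightarrow> 'n \<Rightarrow> complex ^ ('n \<times> 'n)" where
  "ket i j = axis (i, j) 1"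

abbreviation mat2 :: "complex \<Rightarrow> complex \<Rightarrow> complex \<Rightarrow> complex \<Rightarrow> complex ^ 2 ^ 2" where
  "mat2 a b c d \<equiv> vector [vector [a, b], vector [c, d]]"

text \<open>
  The rows of \<open>A i j\<close> hold the coefficients of the images of \<open>ket i j\<close> and \<open>ket j i\<close>; hence
  \<open>A i j\<close> is the transpose of the corresponding block of the matrix \<open>R\<close>.
  Only the values \<open>A i j\<close> with \<open>i < j\<close> matter.
\<close>

definition has_cc_coeffs ::
  "'n::{finite, linorder} operator \<Rightarrow> ('n \<Rightarrow> complex) \<Rightarrow> ('n \<Rightarrow> 'n \<Rightarrow> complex ^ 2 ^ 2) \<Rightarrow> bool" where
  "has_cc_coeffs R a A \<longleftrightarrow>
     (\<forall>i. R *v ket i i = a i *s ket i i) \<and>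
     (\<forall>i j. i < j \<longrightarrow>
        R *v ket i j = A i j $ 1 $ 1 *s ket i j + A i j $ 1 $ 2 *s ket j i \<and>
        R *v ket j i = A i j $ 2 $ 1 *s ket i j + A i j $ 2 $ 2 *s ket j i)"

definition charge_conserving :: "'n::{finite, linorder} operator \<Rightarrow> bool" where
  "charge_conserving R \<longleftrightarrow> (\<exists>a A. has_cc_coeffs R a A)"

definition cc_operator ::
  "('n::{finite, linorder} \<Rightarrow> complex) \<Rightarrow> ('n \<Rightarrow> 'n \<Rightarrow> complex ^ 2 ^ 2) \<Rightarrow> 'n operator" where
  "cc_operator a A = (\<chi> r c. case c of (i, j) \<Rightarrow>
     (if i = j then a i *s ket i i
      else if i < j then A i j $ 1 $ 1 *s ket i j + A i j $ 1 $ 2 *s ket j i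
      else A j i $ 2 $ 1 *s ket j i + A j i $ 2 $ 2 *s ket i j) $ r)"

lemma mult_ket_nth: "(R *v ket i j) $ r = R $ r $ (i, j)"
  by (simp add: ket_def matrix_vector_mult_def axis_def if_distrib cong: if_cong)

text \<open>\<open>cc_operator a A\<close> is the unique operator with the coefficients \<open>a\<close> and \<open>A\<close>.\<close>

lemma has_cc_coeffs_iff: "has_cc_coeffs R a A \<longleftrightarrow> R = cc_operator a A"
proof
  assume "has_cc_coeffs R a A"
  then show "R = cc_operator a A"
    unfolding has_cc_coeffs_def vec_eq_iff[of _ "cc_operator a A"]
    by (intro allI)
      (auto simp: cc_operator_def vec_eq_iff mult_ket_nth split: prod.split)
next
  assume "R = cc_operator a A"
  then show "has_cc_coeffs R a A"
    by (auto simp: has_cc_coeffs_def vec_eq_iff mult_ket_nth cc_operator_def)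
qed

definition tensor_id_right ::
  "'n::finite operator \<Rightarrow> complex ^ ('n \<times> 'n \<times> 'n) ^ ('n \<times> 'n \<times> 'n)" where
  "tensor_id_right R =
     (\<chi> r c. case (r, c) of ((i, j, k), (i', j', k')) \<Rightarrow> R $ (i, j) $ (i', j') * mat 1 $ k $ k')"

definition id_tensor_left ::
  "'n::finite operator \<Rightarrow> complex ^ ('n \<times> 'n \<times> 'n) ^ ('n \<times> 'n \<times> 'n)" where
  "id_tensor_left R =
     (\<chi> r c. case (r, c) of ((i, j, k), (i', j', k')) \<Rightarrow> mat 1 $ i $ i' * R $ (j, k) $ (j', k'))"

definition cc_braid_rep :: "'n::{finite, linorder} operator \<Rightarrow> bool" where
  "cc_braid_rep R \<longleftrightarrow> charge_conserving R \<and> invertible R \<and>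
     tensor_id_right R ** id_tensor_left R ** tensor_id_right R =
     id_tensor_left R ** tensor_id_right R ** id_tensor_left R"

definition X_equivalent :: "'n::finite operator \<Rightarrow> 'n operator \<Rightarrow> bool" where
  "X_equivalent R R' \<longleftrightarrow>
     (\<exists>X :: 'n operator. invertible X \<and> (\<forall>r c. r \<noteq> c \<longrightarrow> X $ r $ c = 0) \<and>
        R' = X ** R ** matrix_inv X)"

text \<open>
  Choices made for each nation are total functions on sets of vertices; their values at sets that
  are not nations are irrelevant. Orders are reflexive, as in \<^const>\<open>linear_order_on\<close>.
\<close>

record 'n configuration =
  nations :: "'n set set"
  counties :: "'n set set"
  county_order :: "'n set \<Rightarrow> 'n set rel"
  county_split :: "'n set \<Rightarrow> 'n set set set"

definition counties_in :: "'n configuration \<Rightarrow> 'n set \<Rightarrow> 'n set set" where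
  "counties_in S n = {c \<in> counties S. c \<subseteq> n}"

definition configurations :: "'n configuration set" where
  "configurations = {S.
     partition_on UNIV (nations S) \<and>
     refines UNIV (counties S) (nations S) \<and>
     (\<forall>n \<in> nations S.
        linear_order_on (counties_in S n) (county_order S n) \<and>
        partition_on (counties_in S n) (county_split S n) \<and> card (county_split S n) \<le> 2)}"

record 'n germ =
  config :: "'n configuration"
  alpha :: "'n set \<Rightarrow> complex"
  beta :: "'n set \<Rightarrow> complex"
  mu :: "'n set \<Rightarrow> 'n set \<Rightarrow> complex"

definition germs :: "'n germ set" where
  "germs = {g.
     config g \<in> configurations \<and>
     (\<forall>n \<in> nations (config g). alpha g n \<noteq> 0) \<and>
     (\<forall>n \<in> nations (config g). card (counties_in (config g) n) > 1 \<longrightarrow>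
        beta g n \<noteq> 0 \<and> alpha g n + beta g n \<noteq> 0) \<and>
     (\<forall>n \<in> nations (config g). \<forall>n' \<in> nations (config g). n \<noteq> n' \<longrightarrow>
        mu g n n' \<noteq> 0 \<and> mu g n n' = mu g n' n)}"

definition nation_of :: "'n configuration \<Rightarrow> 'n \<Rightarrow> 'n set" where
  "nation_of S i = (THE n. n \<in> nations S \<and> i \<in> n)"

definition county_of :: "'n configuration \<Rightarrow> 'n \<Rightarrow> 'n set" where
  "county_of S i = (THE c. c \<in> counties S \<and> i \<in> c)"

definition first_county :: "'n configuration \<Rightarrow> 'n set \<Rightarrow> 'n set" where
  "first_county S n =
     (THE c. c \<in> counties_in S n \<and> (\<forall>c' \<in> counties_in S n. (c, c') \<in> county_order S n))"

definition vertex_coeff :: "'n germ \<Rightarrow> 'n \<Rightarrow> complex" where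
  "vertex_coeff g i =
     (let S = config g; n = nation_of S i in
      if \<exists>B \<in> county_split S n. county_of S i \<in> B \<and> first_county S n \<in> B
      then alpha g n else beta g n)"

definition edge_matrix :: "'n germ \<Rightarrow> 'n \<Rightarrow> 'n \<Rightarrow> complex ^ 2 ^ 2" where
  "edge_matrix g i j =
     (let S = config g; n = nation_of S i; n' = nation_of S j;
          c = county_of S i; c' = county_of S j in
      if n \<noteq> n' then mat2 0 (mu g n n') (mu g n n') 0
      else if c = c' then mat2 (vertex_coeff g i) 0 0 (vertex_coeff g i)
      else if (c, c') \<in> county_order S n
      then mat2 (alpha g n + beta g n) 1 (- (alpha g n * beta g n)) 0
      else mat2 0 1 (- (alpha g n * beta g n)) (alpha g n + beta g n))"

definition recipe :: "'n::{finite, linorder} germ \<Rightarrow> 'n operator" where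
  "recipe g = cc_operator (vertex_coeff g) (edge_matrix g)"

end

theory Submission
  imports Defs
begin

text \<open>
  Setting \<open>p i i = a i\<close> and \<open>s i i = 0\<close>, a charge-conserving operator sends \<open>ket i j\<close> to
  \<open>p i j *s ket i j + s i j *s ket j i\<close>. With this convention the braid relation becomes three scalar
  identities for every triple of vertices, repeated ones included, and the operator is invertible
  iff \<open>p i j * p j i \<noteq> s i j * s j i\<close> throughout. Up to X-equivalence only \<open>p\<close> and the products
  \<open>s i j * s j i\<close> matter.

  For a solution, \<open>p i j \<noteq> 0\<close> is a preorder whose comparability is an equivalence relation. Its
  comparability classes are the nations, its equivalence classes the counties, and it orders the
  counties of each nation. Within a nation \<open>p i j\<close> takes the same value \<open>\<alpha> + \<beta>\<close> on all strictly
  ordered pairs, so all \<open>p i i\<close> are roots of one quadratic polynomial, with roots \<open>\<alpha>\<close> and \<open>\<beta>\<close>;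
  between two nations the product \<open>s i j * s j i\<close> is constant, and \<open>\<mu>\<close> is a square root of it.
\<close>

section \<open>Charge-conserving operators\<close>

text \<open>For \<open>i = j\<close> the two kets coincide and only \<open>p i i + s i i\<close>
  matters; the convention \<open>s i i = 0\<close> removes this ambiguity.\<close>

definition exchange :: "('n::finite \<Rightarrow> 'n \<Rightarrow> complex) \<Rightarrow> ('n \<Rightarrow> 'n \<Rightarrow> complex) \<Rightarrow> 'n operator" where
  "exchange p s =
     (\<chi> r c. case c of (i, j) \<Rightarrow> (p i j *s ket i j + s i j *s ket j i) $ r)"

lemma exchange_ket [simp]: "exchange p s *v ket i j = p i j *s ket i j + s i j *s ket j i"
  by (auto simp: vec_eq_iff mult_ket_nth exchange_def)

lemma ket_nth: "ket i j $ (k, l) = (if k = i \<and> l = j then 1 else 0)"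
  by (auto simp: ket_def axis_def)

lemma operator_eqI:
  assumes "\<And>i j. R *v ket i j = R' *v ket i j"
  shows "R = R'"
proof -
  have "R $ r $ (i, j) = R' $ r $ (i, j)" for r i j
    using arg_cong[OF assms[of i j], of "\<lambda>v. v $ r"] by (simp add: mult_ket_nth)
  then show ?thesis
    by (auto simp: vec_eq_iff)
qed

lemmas apply_linear = vector_scalar_commute matrix_vector_mul_assoc[symmetric]

lemma exchange_mult:
  "exchange p s ** exchange p' s' =
   exchange (\<lambda>i j. p' i j * p i j + s' i j * s j i) (\<lambda>i j. p' i j * s i j + s' i j * p j i)"
  by (rule operator_eqI) (simp add: apply_linear vec_eq_iff algebra_simps)

lemma exchange_eq_mat_1:
  assumes "\<And>i j. p i j = 1" "\<And>i j. s i j = 0"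
  shows "exchange p s = mat 1"
  by (rule operator_eqI) (simp add: assms)

text \<open>For \<open>j < i\<close> the vector \<open>ket i j\<close> is the second one of its
  block, so the second row of \<open>A j i\<close> is read backwards: its second entry keeps the ket
  and its first entry swaps it.\<close>

lemma cc_operator_eq_exchange:
  "cc_operator a A = exchange
     (\<lambda>i j. if i = j then a i else if i < j then A i j $ 1 $ 1 else A j i $ 2 $ 2)
     (\<lambda>i j. if i = j then 0 else if i < j then A i j $ 1 $ 2 else A j i $ 2 $ 1)"
proof -
  have "has_cc_coeffs (cc_operator a A) a A"
    by (simp add: has_cc_coeffs_iff)
  then show ?thesis
    unfolding has_cc_coeffs_def by (intro operator_eqI) (auto simp: not_less add.commute)
qed

lemma charge_conserving_cc_operator: "charge_conserving (cc_operator a A)"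
  unfolding charge_conserving_def has_cc_coeffs_iff by blast

lemma charge_conserving_imp_exchange:
  assumes "charge_conserving R"
  obtains p s where "R = exchange p s" "\<And>i. s i i = 0"
proof -
  obtain a A where "R = cc_operator a A"
    using assms unfolding charge_conserving_def has_cc_coeffs_iff by blast
  from that[OF this[unfolded cc_operator_eq_exchange]] show thesis
    by simp
qed

text \<open>Each span of \<open>ket i j\<close> and \<open>ket j i\<close> is invariant, and
  \<open>p i j * p j i - s i j * s j i\<close> is the determinant of that block; for
  \<open>i = j\<close> the condition reads \<open>p i i \<noteq> 0\<close>.\<close>

lemma invertible_exchange_iff:
  assumes diag: "\<And>i. s i i = 0"
  shows "invertible (exchange p s) \<longleftrightarrow> (\<forall>i j. p i j * p j i \<noteq> s i j * s j i)"
proof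
  assume inv: "invertible (exchange p s)"
  have kernel: "v = 0" if "exchange p s *v v = 0" for v
    using inv that by (metis invertible_def matrix_vector_mul_assoc matrix_vector_mul_lid matrix_vector_mult_0_right)
  show "\<forall>i j. p i j * p j i \<noteq> s i j * s j i"
  proof (intro allI notI)
    fix i j
    assume deg: "p i j * p j i = s i j * s j i"
    \<comment> \<open>Both vectors come from the adjugate of the singular block. Since they vanish,
      so do \<open>p i j\<close> and \<open>s i j\<close>, which puts \<open>ket i j\<close> itself
      into the kernel.\<close>
    have v: "p j i *s ket i j + (- s i j) *s ket j i = 0"
      by (rule kernel) (use deg in \<open>auto simp: apply_linear vec_eq_iff algebra_simps\<close>)
    have w: "s j i *s ket i j + (- p i j) *s ket j i = 0"
      by (rule kernel) (use deg in \<open>auto simp: apply_linear vec_eq_iff algebra_simps\<close>)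
    have "p i j = 0 \<and> s i j = 0"
    proof (cases "i = j")
      case True
      then show ?thesis
        using deg diag by simp
    next
      case False
      then show ?thesis
        using arg_cong[OF v, of "\<lambda>u. u $ (j, i)"] arg_cong[OF w, of "\<lambda>u. u $ (j, i)"]
        by (simp add: ket_nth)
    qed
    then have "ket i j = 0"
      by - (rule kernel, simp)
    from arg_cong[OF this, of "\<lambda>u. u $ (i, j)"] show False
      by (simp add: ket_nth)
  qed
next
  assume nz: "\<forall>i j. p i j * p j i \<noteq> s i j * s j i"
  define D where "D i j = p i j * p j i - s i j * s j i" for i j
  have D: "D i j \<noteq> 0" "D j i = D i j" for i j
    using nz[rule_format, of i j] by (simp_all add: D_def mult.commute)
  \<comment> \<open>Blockwise, this is the adjugate divided by the determinant.\<close>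
  have "exchange p s ** exchange (\<lambda>i j. p j i / D i j) (\<lambda>i j. - s i j / D i j) = mat 1"
    unfolding exchange_mult
  proof (rule exchange_eq_mat_1)
    fix i j
    have "p j i / D i j * p i j + - s i j / D i j * s j i = D i j / D i j"
      unfolding D_def by (simp add: divide_simps)
    then show "p j i / D i j * p i j + - s i j / D i j * s j i = 1"
      using D by simp
    show "p j i / D i j * s i j + - s i j / D i j * p j i = 0"
      by simp
  qed
  then show "invertible (exchange p s)"
    unfolding invertible_right_inverse by blast
qed

text \<open>Conjugation by a diagonal operator with entries \<open>x i j\<close> fixes
  \<open>p\<close> and multiplies \<open>s i j\<close> by \<open>x j i / x i j\<close>, hence
  preserves \<open>s i j * s j i\<close>. Conversely, equal products suffice once the zeros are
  symmetric and match.\<close>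

lemma X_equivalent_exchange:
  fixes s s' :: "'n::{finite, linorder} \<Rightarrow> 'n \<Rightarrow> complex"
  assumes "\<And>i. s i i = 0" "\<And>i. s' i i = 0"
    and prod: "\<And>i j. s' i j * s' j i = s i j * s j i"
    and sym: "\<And>i j. s i j = 0 \<longleftrightarrow> s j i = 0"
    and zero: "\<And>i j. s i j = 0 \<longleftrightarrow> s' i j = 0"
  shows "X_equivalent (exchange p s) (exchange p s')"
proof -
  \<comment> \<open>Only entries at decreasing pairs differ from 1; they carry \<open>s\<close> to
    \<open>s'\<close> on the increasing pairs, and equality of the products settles the decreasing
    ones.\<close>
  define x where "x i j = (if j < i \<and> s j i \<noteq> 0 then s' j i / s j i else 1)" for i j
  define X where "X = exchange x (\<lambda>_ _. 0)"
  define Y where "Y = exchange (\<lambda>i j. 1 / x i j) (\<lambda>_ _. 0)"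
  have x: "x i j \<noteq> 0" for i j
    using zero by (auto simp: x_def)
  have XY: "X ** Y = mat 1"
    unfolding X_def Y_def exchange_mult by (rule exchange_eq_mat_1) (auto simp: x)
  then have YX: "Y ** X = mat 1"
    using matrix_left_right_inverse by blast
  have inv: "invertible X"
    using XY invertible_right_inverse by blast
  \<comment> \<open>\<open>matrix_inv\<close> chooses some two-sided inverse; \<open>Y\<close>
    witnesses that one exists, and uniqueness then identifies the two.\<close>
  have "X ** matrix_inv X = mat 1 \<and> matrix_inv X ** X = mat 1"
    unfolding matrix_inv_def by (rule someI[of _ Y]) (simp add: XY YX)
  then have "matrix_inv X ** (X ** Y) = Y"
    by (simp add: matrix_mul_assoc)
  then have "matrix_inv X = Y"
    by (simp add: XY)
  have swap: "s i j / x i j * x j i = s' i j" for i j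
  proof (cases i j rule: linorder_cases)
    case less
    then show ?thesis
      using zero[of i j] by (auto simp: x_def)
  next
    case equal
    then show ?thesis
      using assms by simp
  next
    case greater
    then show ?thesis
      using zero[of i j] zero[of j i] sym[of i j] prod[of i j]
      by (auto simp: x_def field_simps not_less)
  qed
  have "X ** exchange p s ** Y = exchange p s'"
    unfolding X_def Y_def exchange_mult
    by (rule arg_cong2[of _ _ _ _ exchange]) (auto simp: fun_eq_iff x swap[symmetric])
  moreover have "\<forall>r c. r \<noteq> c \<longrightarrow> X $ r $ c = 0"
    by (auto simp: X_def exchange_def ket_nth)
  ultimately show ?thesis
    unfolding X_equivalent_def using inv \<open>matrix_inv X = Y\<close> by metis
qed

section \<open>The braid relation in coordinates\<close>

definition ket3 :: "'n::finite \<Rightarrow> 'n \<Rightarrow> 'n \<Rightarrow> complex ^ ('n \<times> 'n \<times> 'n)" where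
  "ket3 i j k = axis (i, j, k) 1"

lemma ket3_nth: "ket3 i j k $ (i', j', k') = (if i' = i \<and> j' = j \<and> k' = k then 1 else 0)"
  by (auto simp: ket3_def axis_def)

lemma mult_ket3_nth: "(M *v ket3 i j k) $ r = M $ r $ (i, j, k)"
  by (simp add: ket3_def matrix_vector_mult_def axis_def if_distrib cong: if_cong)

lemma matrix_eq_ket3: "M = M' \<longleftrightarrow> (\<forall>i j k. M *v ket3 i j k = M' *v ket3 i j k)"
  by (auto simp: vec_eq_iff mult_ket3_nth)

lemma tensor_id_right_exchange_ket3:
  "tensor_id_right (exchange p s) *v ket3 i j k = p i j *s ket3 i j k + s i j *s ket3 j i k"
proof -
  have "(tensor_id_right (exchange p s) *v ket3 i j k) $ (a, b, c) =
        (p i j *s ket3 i j k + s i j *s ket3 j i k) $ (a, b, c)" for a b c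
    unfolding mult_ket3_nth
    by (cases "c = k") (simp_all add: tensor_id_right_def exchange_def ket_nth ket3_nth mat_def)
  then show ?thesis
    by (simp only: vec_eq_iff split_paired_All simp_thms)
qed

lemma id_tensor_left_exchange_ket3:
  "id_tensor_left (exchange p s) *v ket3 i j k = p j k *s ket3 i j k + s j k *s ket3 i k j"
proof -
  have "(id_tensor_left (exchange p s) *v ket3 i j k) $ (a, b, c) =
        (p j k *s ket3 i j k + s j k *s ket3 i k j) $ (a, b, c)" for a b c
    unfolding mult_ket3_nth
    by (cases "a = i") (simp_all add: id_tensor_left_def exchange_def ket_nth ket3_nth mat_def)
  then show ?thesis
    by (simp only: vec_eq_iff split_paired_All simp_thms)
qed

lemma ket3_combination_eq_0_iff:
  assumes "i = j \<Longrightarrow> y = 0" "j = k \<Longrightarrow> z = 0"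
  shows "x *s ket3 i j k + y *s ket3 j i k + z *s ket3 i k j = 0 \<longleftrightarrow> x = 0 \<and> y = 0 \<and> z = 0"
proof
  assume "x *s ket3 i j k + y *s ket3 j i k + z *s ket3 i k j = 0"
  then have n: "(x *s ket3 i j k + y *s ket3 j i k + z *s ket3 i k j) $ r = 0" for r
    by simp
  have "y = 0"
    using n[of "(j, i, k)"] assms by (cases "i = j") (simp_all add: ket3_nth)
  moreover have "z = 0"
    using n[of "(i, k, j)"] assms by (cases "j = k") (simp_all add: ket3_nth)
  ultimately show "x = 0 \<and> y = 0 \<and> z = 0"
    using n[of "(i, j, k)"] by (simp add: ket3_nth)
qed simp

text \<open>The two sides of the braid relation applied to \<open>ket3 i j k\<close> are compared at
  \<open>ket3 i j k\<close>, \<open>ket3 j i k\<close> and \<open>ket3 i k j\<close>; at the other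
  permutations they agree identically.\<close>

definition braid_coeffs ::
  "('n \<Rightarrow> 'n \<Rightarrow> complex) \<Rightarrow> ('n \<Rightarrow> 'n \<Rightarrow> complex) \<Rightarrow> 'n \<Rightarrow> 'n \<Rightarrow> 'n \<Rightarrow> bool" where
  "braid_coeffs p s i j k \<longleftrightarrow>
     (p i j)\<^sup>2 * p j k + s i j * s j i * p i k = p i j * (p j k)\<^sup>2 + s j k * s k j * p i k \<and>
     s i j * (p i j * p j k + p i k * p j i - p j k * p i k) = 0 \<and>
     s j k * (p i j * p i k - p i j * p j k - p i k * p k j) = 0"

lemma braid_relation_exchange_iff:
  fixes p s :: "'n::finite \<Rightarrow> 'n \<Rightarrow> complex"
  assumes diag: "\<And>i. s i i = 0"
  defines "R \<equiv> exchange p s"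
  shows "tensor_id_right R ** id_tensor_left R ** tensor_id_right R =
         id_tensor_left R ** tensor_id_right R ** id_tensor_left R \<longleftrightarrow> (\<forall>i j k. braid_coeffs p s i j k)"
proof -
  let ?e1 = "\<lambda>i j k. (p i j)\<^sup>2 * p j k + s i j * s j i * p i k
                    - (p i j * (p j k)\<^sup>2 + s j k * s k j * p i k)"
  let ?e2 = "\<lambda>i j k. s i j * (p i j * p j k + p i k * p j i - p j k * p i k)"
  let ?e3 = "\<lambda>i j k. s j k * (p i j * p i k - p i j * p j k - p i k * p k j)"
  let ?d = "\<lambda>i j k. ?e1 i j k *s ket3 i j k + ?e2 i j k *s ket3 j i k + ?e3 i j k *s ket3 i k j"
  let ?L = "tensor_id_right R ** id_tensor_left R ** tensor_id_right R"
  let ?M = "id_tensor_left R ** tensor_id_right R ** id_tensor_left R"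
  have diff: "?L *v ket3 i j k - ?M *v ket3 i j k = ?d i j k" for i j k
    by (simp add: R_def apply_linear tensor_id_right_exchange_ket3 id_tensor_left_exchange_ket3
        vec_eq_iff algebra_simps power2_eq_square)
  have "?L = ?M \<longleftrightarrow> (\<forall>i j k. ?L *v ket3 i j k - ?M *v ket3 i j k = 0)"
    by (simp add: matrix_eq_ket3)
  also have "\<dots> \<longleftrightarrow> (\<forall>i j k. ?d i j k = 0)"
    unfolding diff ..
  also have "\<dots> \<longleftrightarrow> (\<forall>i j k. ?e1 i j k = 0 \<and> ?e2 i j k = 0 \<and> ?e3 i j k = 0)"
  proof (intro iff_allI)
    fix i j k
    show "?d i j k = 0 \<longleftrightarrow> ?e1 i j k = 0 \<and> ?e2 i j k = 0 \<and> ?e3 i j k = 0"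
      by (rule ket3_combination_eq_0_iff) (use diag in auto)
  qed
  also have "\<dots> \<longleftrightarrow> (\<forall>i j k. braid_coeffs p s i j k)"
    by (simp add: braid_coeffs_def)
  finally show ?thesis .
qed

lemma cc_braid_rep_exchange_iff:
  assumes "\<And>i. s i i = 0" "charge_conserving (exchange p s)"
  shows "cc_braid_rep (exchange p s) \<longleftrightarrow>
           (\<forall>i j. p i j * p j i \<noteq> s i j * s j i) \<and> (\<forall>i j k. braid_coeffs p s i j k)"
  unfolding cc_braid_rep_def invertible_exchange_iff[of s, OF assms(1)]
    braid_relation_exchange_iff[of s, OF assms(1)]
  using assms(2) by blast

section \<open>The recipe yields braid representations\<close>

text \<open>Stated for total preorders so that it serves both the ordered counties of a nation and
  its vertices under \<open>p i j \<noteq> 0\<close>, where distinct vertices may be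
  equivalent.\<close>

lemma finite_total_preorder_least:
  assumes "finite A" "A \<noteq> {}"
    and total: "\<And>x y. x \<in> A \<Longrightarrow> y \<in> A \<Longrightarrow> r x y \<or> r y x"
    and trans: "\<And>x y z. x \<in> A \<Longrightarrow> y \<in> A \<Longrightarrow> z \<in> A \<Longrightarrow> r x y \<Longrightarrow> r y z \<Longrightarrow> r x z"
  obtains x where "x \<in> A" "\<And>y. y \<in> A \<Longrightarrow> r x y"
proof -
  have "\<exists>x\<in>F. \<forall>y\<in>F. r x y" if "finite F" "F \<noteq> {}" "F \<subseteq> A" for F
    using that
  proof (induction rule: finite_ne_induct)
    case (singleton x)
    then show ?case
      using total[of x x] by auto
  next
    case (insert x F)
    then have "\<exists>m\<in>F. \<forall>y\<in>F. r m y" "x \<in> A"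
      by auto
    then obtain m where m: "m \<in> F" "\<forall>y\<in>F. r m y"
      by blast
    then have "m \<in> A"
      using insert.prems by auto
    show ?case
    proof (cases "r m x")
      case True
      then show ?thesis
        using m by blast
    next
      case False
      then have "r x m" "r x x"
        using total[of x m] total[of x x] \<open>x \<in> A\<close> \<open>m \<in> A\<close> by auto
      moreover have "r x y" if "y \<in> F" for y
        using trans[of x m y] \<open>x \<in> A\<close> \<open>m \<in> A\<close> \<open>r x m\<close> m(2) that insert.prems by auto
      ultimately show ?thesis
        by auto
    qed
  qed
  from this[of A] show thesis
    using assms(1,2) that by auto
qed

lemma partition_on_UNIV_the:
  assumes "partition_on UNIV P"
  shows "(THE X. X \<in> P \<and> i \<in> X) \<in> P" "i \<in> (THE X. X \<in> P \<and> i \<in> X)"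
    and "X \<in> P \<Longrightarrow> i \<in> X \<Longrightarrow> (THE X. X \<in> P \<and> i \<in> X) = X"
proof -
  have ex: "\<exists>!X. X \<in> P \<and> i \<in> X"
    using assms by (auto simp: partition_on_def disjoint_def)
  show "(THE X. X \<in> P \<and> i \<in> X) \<in> P" "i \<in> (THE X. X \<in> P \<and> i \<in> X)"
    using theI'[OF ex] by blast+
  show "(THE X. X \<in> P \<and> i \<in> X) = X" if "X \<in> P" "i \<in> X"
    using the1_equality[OF ex, of X] that by blast
qed

section \<open>Nations and counties of a configuration\<close>

context
  fixes S :: "'n::finite configuration"
  assumes S: "S \<in> configurations"
begin

lemma partition_nations: "partition_on UNIV (nations S)"
  and partition_counties: "partition_on UNIV (counties S)"
  and county_subset_nation: "c \<in> counties S \<Longrightarrow> \<exists>n\<in>nations S. c \<subseteq> n"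
  and linear_order_counties: "n \<in> nations S \<Longrightarrow> linear_order_on (counties_in S n) (county_order S n)"
  and partition_split: "n \<in> nations S \<Longrightarrow> partition_on (counties_in S n) (county_split S n)"
  using S by (auto simp: configurations_def refines_def)

lemma nation_of: "nation_of S i \<in> nations S" "i \<in> nation_of S i"
  and nation_of_eqI: "n \<in> nations S \<Longrightarrow> i \<in> n \<Longrightarrow> nation_of S i = n"
  unfolding nation_of_def using partition_on_UNIV_the[OF partition_nations] by auto

lemma county_of: "county_of S i \<in> counties S" "i \<in> county_of S i"
  and county_of_eqI: "c \<in> counties S \<Longrightarrow> i \<in> c \<Longrightarrow> county_of S i = c"
  unfolding county_of_def using partition_on_UNIV_the[OF partition_counties] by auto

lemma county_of_in: "county_of S i \<in> counties_in S (nation_of S i)"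
proof -
  obtain n where "n \<in> nations S" "county_of S i \<subseteq> n"
    using county_subset_nation county_of by blast
  moreover from this have "nation_of S i = n"
    using county_of by (intro nation_of_eqI) auto
  ultimately show ?thesis
    using county_of by (simp add: counties_in_def)
qed

lemma county_of_eq_imp_nation_of_eq:
  assumes "county_of S i = county_of S j"
  shows "nation_of S i = nation_of S j"
proof -
  have "i \<in> nation_of S j"
    using assms county_of(2)[of i] county_of_in[of j] by (auto simp: counties_in_def)
  then show ?thesis
    using nation_of by (intro nation_of_eqI)
qed

lemma county_order_properties:
  assumes "n \<in> nations S"
  shows "c \<in> counties_in S n \<Longrightarrow> d \<in> counties_in S n \<Longrightarrow>
           (c, d) \<in> county_order S n \<or> (d, c) \<in> county_order S n"
    and "(c, d) \<in> county_order S n \<Longrightarrow> (d, e) \<in> county_order S n \<Longrightarrow> (c, e) \<in> county_order S n"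
    and "(c, d) \<in> county_order S n \<Longrightarrow> (d, c) \<in> county_order S n \<Longrightarrow> c = d"
  using linear_order_counties[OF assms] unfolding order_on_defs total_on_def refl_on_def
  by (metis, (blast dest: transD antisymD)+)

lemma first_county_eqI:
  assumes "n \<in> nations S" "c \<in> counties_in S n"
    and "\<And>d. d \<in> counties_in S n \<Longrightarrow> (c, d) \<in> county_order S n"
  shows "first_county S n = c"
  unfolding first_county_def
  using assms county_order_properties(3)[OF assms(1)] by (intro the_equality) auto

lemma first_county_in:
  assumes "n \<in> nations S"
  shows "first_county S n \<in> counties_in S n"
proof -
  obtain i where "i \<in> n"
    using assms partition_onD3[OF partition_nations] by (metis ex_in_conv)
  then have "counties_in S n \<noteq> {}"
    using county_of_in[of i] nation_of_eqI[OF assms] by auto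
  with finite obtain c where c: "c \<in> counties_in S n"
    "\<And>d. d \<in> counties_in S n \<Longrightarrow> (c, d) \<in> county_order S n"
  proof (rule finite_total_preorder_least[where r = "\<lambda>c d. (c, d) \<in> county_order S n"])
    show "(c, d) \<in> county_order S n \<or> (d, c) \<in> county_order S n"
      if "c \<in> counties_in S n" "d \<in> counties_in S n" for c d
      using that by (rule county_order_properties(1)[OF assms])
    show "(c, e) \<in> county_order S n"
      if "(c, d) \<in> county_order S n" "(d, e) \<in> county_order S n" for c d e
      using that by (rule county_order_properties(2)[OF assms])
  qed blast
  have "first_county S n = c"
    using c by (rule first_county_eqI[OF assms])
  then show ?thesis
    using c(1) by simp
qed

end

text \<open>
  The coefficient identities for three vertices of one nation with eigenvalues \<open>A\<close> and \<open>B\<close>;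
  a Boolean such as \<open>ij\<close> says that the county of \<open>i\<close> precedes or equals that of \<open>j\<close>.
\<close>

lemma weak_order_equations:
  fixes A B ai aj ak :: complex
  assumes order: "ij \<or> ji" "jk \<or> kj" "ik \<or> ki"
      "ij \<Longrightarrow> jk \<Longrightarrow> ik" "ik \<Longrightarrow> kj \<Longrightarrow> ij" "ji \<Longrightarrow> ik \<Longrightarrow> jk"
      "jk \<Longrightarrow> ki \<Longrightarrow> ji" "ki \<Longrightarrow> ij \<Longrightarrow> kj" "kj \<Longrightarrow> ji \<Longrightarrow> ki"
    and same: "ij \<Longrightarrow> ji \<Longrightarrow> ai = aj" "jk \<Longrightarrow> kj \<Longrightarrow> aj = ak" "ik \<Longrightarrow> ki \<Longrightarrow> ai = ak"
    and root: "ai = A \<or> ai = B" "aj = A \<or> aj = B" "ak = A \<or> ak = B"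
    and diag: "pij = (if ij then if ji then ai else A + B else 0)"
      "pji = (if ji then if ij then aj else A + B else 0)"
      "pjk = (if jk then if kj then aj else A + B else 0)"
      "pkj = (if kj then if jk then ak else A + B else 0)"
      "pik = (if ik then if ki then ai else A + B else 0)"
    and prod: "tij = (if ij \<and> ji then 0 else - (A * B))" "tjk = (if jk \<and> kj then 0 else - (A * B))"
  shows "pij\<^sup>2 * pjk + tij * pik = pij * pjk\<^sup>2 + tjk * pik \<and>
         (ij \<and> ji \<or> pij * pjk + pik * pji - pjk * pik = 0) \<and>
         (jk \<and> kj \<or> pij * pik - pij * pjk - pik * pkj = 0)"
proof -
  \<comment> \<open>These are the thirteen weak orders on three labelled elements. What remains in
    each is a polynomial identity in \<open>A\<close>, \<open>B\<close> and the vertex coefficients,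
    each of which is \<open>A\<close> or \<open>B\<close>.\<close>
  have "(ij \<and> ji \<and> jk \<and> kj \<and> ik \<and> ki) \<or>
        (ij \<and> ji \<and> jk \<and> \<not> kj \<and> ik \<and> \<not> ki) \<or>
        (ij \<and> \<not> ji \<and> \<not> jk \<and> kj \<and> ik \<and> ki) \<or>
        (ij \<and> \<not> ji \<and> jk \<and> kj \<and> ik \<and> \<not> ki) \<or>
        (ij \<and> \<not> ji \<and> jk \<and> \<not> kj \<and> ik \<and> \<not> ki) \<or>
        (ij \<and> \<not> ji \<and> \<not> jk \<and> kj \<and> ik \<and> \<not> ki) \<or>
        (\<not> ij \<and> ji \<and> jk \<and> kj \<and> \<not> ik \<and> ki) \<or>
        (\<not> ij \<and> ji \<and> jk \<and> \<not> kj \<and> ik \<and> ki) \<or>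
        (\<not> ij \<and> ji \<and> jk \<and> \<not> kj \<and> ik \<and> \<not> ki) \<or>
        (ij \<and> ji \<and> \<not> jk \<and> kj \<and> \<not> ik \<and> ki) \<or>
        (ij \<and> \<not> ji \<and> \<not> jk \<and> kj \<and> \<not> ik \<and> ki) \<or>
        (\<not> ij \<and> ji \<and> jk \<and> \<not> kj \<and> \<not> ik \<and> ki) \<or>
        (\<not> ij \<and> ji \<and> \<not> jk \<and> kj \<and> \<not> ik \<and> ki)"
    using order by argo
  then show ?thesis
    by (elim disjE) (simp_all add: diag prod same, use root in \<open>auto simp: power2_eq_square algebra_simps\<close>)
qed

section \<open>The coefficients of the recipe operator\<close>

definition germ_diag :: "'n::finite germ \<Rightarrow> 'n \<Rightarrow> 'n \<Rightarrow> complex" where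
  "germ_diag g i j =
     (let S = config g; n = nation_of S i in
      if n \<noteq> nation_of S j then 0
      else if county_of S i = county_of S j then vertex_coeff g i
      else if (county_of S i, county_of S j) \<in> county_order S n then alpha g n + beta g n
      else 0)"

definition germ_swap :: "'n::{finite, linorder} germ \<Rightarrow> 'n \<Rightarrow> 'n \<Rightarrow> complex" where
  "germ_swap g i j =
     (let S = config g; n = nation_of S i; n' = nation_of S j in
      if n \<noteq> n' then mu g n n'
      else if county_of S i = county_of S j then 0
      else if i < j then 1
      else - (alpha g n * beta g n))"

lemma germ_swap_same [simp]: "germ_swap g i i = 0"
  by (simp add: germ_swap_def)

context
  fixes g :: "'n::{finite, linorder} germ"
  assumes g: "g \<in> germs"
begin

lemma germ_config: "config g \<in> configurations"
  using g by (simp add: germs_def)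

lemma germ_mu:
  assumes "nation_of (config g) i \<noteq> nation_of (config g) j"
  shows "mu g (nation_of (config g) i) (nation_of (config g) j) \<noteq> 0"
    and "mu g (nation_of (config g) j) (nation_of (config g) i) =
         mu g (nation_of (config g) i) (nation_of (config g) j)"
  using g assms nation_of(1)[OF germ_config] by (auto simp: germs_def)

lemma vertex_coeff_cong:
  assumes "county_of (config g) i = county_of (config g) j"
  shows "vertex_coeff g i = vertex_coeff g j"
  using assms county_of_eq_imp_nation_of_eq[OF germ_config assms]
  by (auto simp: vertex_coeff_def Let_def)

lemma vertex_coeff_disj:
  "vertex_coeff g i = alpha g (nation_of (config g) i) \<or>
   vertex_coeff g i = beta g (nation_of (config g) i)"
  by (simp add: vertex_coeff_def Let_def)

text \<open>The two matrices for different counties of one nation differ only in the place of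
  \<alpha> + \<beta>, which always multiplies the ket whose first factor lies in the earlier county.
  There \<open>germ_diag\<close> sees only the county order and \<open>germ_swap\<close> only the
  order of the vertices.\<close>

lemma recipe_eq_exchange: "recipe g = exchange (germ_diag g) (germ_swap g)"
proof -
  let ?S = "config g"
  have order: "(county_of ?S i, county_of ?S j) \<in> county_order ?S (nation_of ?S j) \<longleftrightarrow>
      (county_of ?S j, county_of ?S i) \<notin> county_order ?S (nation_of ?S j)"
    if "nation_of ?S i = nation_of ?S j" "county_of ?S i \<noteq> county_of ?S j" for i j
    using that county_order_properties[OF germ_config nation_of(1)[OF germ_config]]
      county_of_in[OF germ_config] by metis
  show ?thesis
    unfolding recipe_def cc_operator_eq_exchange
  proof (intro arg_cong2[of _ _ _ _ exchange] ext)
    fix i j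
    show "(if i = j then vertex_coeff g i
           else if i < j then edge_matrix g i j $ 1 $ 1 else edge_matrix g j i $ 2 $ 2) =
          germ_diag g i j"
      using order[of i j] vertex_coeff_cong[of i j]
      by (auto simp: germ_diag_def edge_matrix_def Let_def)
    show "(if i = j then 0
           else if i < j then edge_matrix g i j $ 1 $ 2 else edge_matrix g j i $ 2 $ 1) =
          germ_swap g i j"
      using germ_mu(2)[of i j]
      by (auto simp: germ_swap_def edge_matrix_def Let_def)
  qed
qed

lemma germ_alpha_beta:
  assumes "nation_of (config g) i = nation_of (config g) j"
    and "county_of (config g) i \<noteq> county_of (config g) j"
  shows "alpha g (nation_of (config g) i) \<noteq> 0" "beta g (nation_of (config g) i) \<noteq> 0"
proof -
  let ?C = "counties_in (config g) (nation_of (config g) i)"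
  have "{county_of (config g) i, county_of (config g) j} \<subseteq> ?C"
    using assms(1) county_of_in[OF germ_config, of i] county_of_in[OF germ_config, of j] by simp
  then have "card {county_of (config g) i, county_of (config g) j} \<le> card ?C"
    by (intro card_mono) simp_all
  then have "card ?C > 1"
    using assms(2) by simp
  then show "alpha g (nation_of (config g) i) \<noteq> 0" "beta g (nation_of (config g) i) \<noteq> 0"
    using g nation_of(1)[OF germ_config] by (auto simp: germs_def)
qed

text \<open>The first county shares a part with itself, so its vertices get \<alpha>. Any other
  county witnesses that the nation has two counties, and then the germ condition makes \<beta>
  nonzero.\<close>

lemma vertex_coeff_nonzero: "vertex_coeff g i \<noteq> 0"
proof -
  let ?S = "config g"
  let ?n = "nation_of ?S i"
  have alpha: "alpha g ?n \<noteq> 0"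
    using g nation_of(1)[OF germ_config] by (auto simp: germs_def)
  have first: "first_county ?S ?n \<in> counties_in ?S ?n"
    by (rule first_county_in[OF germ_config nation_of(1)[OF germ_config]])
  show ?thesis
  proof (cases "county_of ?S i = first_county ?S ?n")
    case True
    obtain B where "B \<in> county_split ?S ?n" "first_county ?S ?n \<in> B"
      using first partition_split[OF germ_config nation_of(1)[OF germ_config]]
      by (metis UnionE partition_onD1)
    then have "vertex_coeff g i = alpha g ?n"
      using True by (auto simp: vertex_coeff_def Let_def)
    then show ?thesis
      using alpha by simp
  next
    case False
    have "card {county_of ?S i, first_county ?S ?n} \<le> card (counties_in ?S ?n)"
      using first county_of_in[OF germ_config] by (intro card_mono) simp_all
    then have "card (counties_in ?S ?n) > 1"
      using False by simp
    then have "beta g ?n \<noteq> 0"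
      using g nation_of(1)[OF germ_config] by (auto simp: germs_def)
    then show ?thesis
      using alpha vertex_coeff_disj[of i] by auto
  qed
qed

lemma germ_swap_prod:
  "germ_swap g i j * germ_swap g j i =
     (if nation_of (config g) i \<noteq> nation_of (config g) j
      then (mu g (nation_of (config g) i) (nation_of (config g) j))\<^sup>2
      else if county_of (config g) i = county_of (config g) j then 0
      else - (alpha g (nation_of (config g) i) * beta g (nation_of (config g) i)))"
  using germ_mu(2)[of i j] by (auto simp: germ_swap_def Let_def power2_eq_square not_less)

lemma germ_swap_eq_0_iff: "germ_swap g i j = 0 \<longleftrightarrow> county_of (config g) i = county_of (config g) j"
  using germ_mu(1)[of i j] germ_alpha_beta[of i j] county_of_eq_imp_nation_of_eq[OF germ_config, of i j]
  by (auto simp: germ_swap_def Let_def)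

text \<open>Exactly one of the two products vanishes: the right one within a county, and the left
  one between counties, because the county order is antisymmetric or the nations differ.\<close>

lemma germ_invertible: "germ_diag g i j * germ_diag g j i \<noteq> germ_swap g i j * germ_swap g j i"
proof -
  let ?S = "config g"
  have "germ_diag g i j * germ_diag g j i = 0"
    if "county_of ?S i \<noteq> county_of ?S j"
    using that county_order_properties(3)[OF germ_config nation_of(1)[OF germ_config]]
    by (auto simp: germ_diag_def Let_def)
  moreover have "germ_diag g i j * germ_diag g j i \<noteq> 0"
    if "county_of ?S i = county_of ?S j"
    using that vertex_coeff_nonzero county_of_eq_imp_nation_of_eq[OF germ_config that]
    by (simp add: germ_diag_def Let_def)
  moreover have "germ_swap g i j * germ_swap g j i = 0 \<longleftrightarrow> county_of ?S i = county_of ?S j"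
    using germ_swap_eq_0_iff[of i j] germ_swap_eq_0_iff[of j i] by auto
  ultimately show ?thesis
    by metis
qed

lemma germ_braid_coeffs_same_nation:
  assumes i: "nation_of (config g) i = n" and j: "nation_of (config g) j = n"
    and k: "nation_of (config g) k = n"
  shows "braid_coeffs (germ_diag g) (germ_swap g) i j k"
proof -
  \<comment> \<open>\<open>L\<close> is the county order pulled back to vertices, a total preorder
    on the nation whose classes are the counties.\<close>
  define L where "L x y \<longleftrightarrow> (county_of (config g) x, county_of (config g) y) \<in> county_order (config g) n"
    for x y
  have n: "n \<in> nations (config g)"
    using i nation_of(1)[OF germ_config] by blast
  note order = county_order_properties[OF germ_config n]
  have L_eq: "county_of (config g) x = county_of (config g) y \<longleftrightarrow> L x y \<and> L y x"
    if "nation_of (config g) x = n" "nation_of (config g) y = n" for x y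
    using that order(1,3) county_of_in[OF germ_config] unfolding L_def by metis
  have diag: "germ_diag g x y =
      (if L x y then if L y x then vertex_coeff g x else alpha g n + beta g n else 0)"
    if "nation_of (config g) x = n" "nation_of (config g) y = n" for x y
    using L_eq[OF that] that by (auto simp: germ_diag_def Let_def L_def)
  have swap: "germ_swap g x y * germ_swap g y x = (if L x y \<and> L y x then 0 else - (alpha g n * beta g n))"
    if "nation_of (config g) x = n" "nation_of (config g) y = n" for x y
    using L_eq[OF that] that by (simp add: germ_swap_prod)
  have swap0: "germ_swap g x y = 0 \<longleftrightarrow> L x y \<and> L y x"
    if "nation_of (config g) x = n" "nation_of (config g) y = n" for x y
    using L_eq[OF that] by (simp add: germ_swap_eq_0_iff)
  have same: "vertex_coeff g x = vertex_coeff g y" if "L x y" "L y x"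
    "nation_of (config g) x = n" "nation_of (config g) y = n" for x y
    by (rule vertex_coeff_cong) (simp add: L_eq that)
  have root: "vertex_coeff g x = alpha g n \<or> vertex_coeff g x = beta g n"
    if "nation_of (config g) x = n" for x
    using vertex_coeff_disj[of x] that by simp
  have total: "L x y \<or> L y x" if "nation_of (config g) x = n" "nation_of (config g) y = n" for x y
    using that order(1) county_of_in[OF germ_config] unfolding L_def by metis
  have trans: "L x y \<Longrightarrow> L y z \<Longrightarrow> L x z" for x y z
    unfolding L_def by (rule order(2))
  have "(germ_diag g i j)\<^sup>2 * germ_diag g j k + germ_swap g i j * germ_swap g j i * germ_diag g i k =
         germ_diag g i j * (germ_diag g j k)\<^sup>2 + germ_swap g j k * germ_swap g k j * germ_diag g i k \<and>
         (L i j \<and> L j i \<or> germ_diag g i j * germ_diag g j k + germ_diag g i k * germ_diag g j i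
           - germ_diag g j k * germ_diag g i k = 0) \<and>
         (L j k \<and> L k j \<or> germ_diag g i j * germ_diag g i k - germ_diag g i j * germ_diag g j k
           - germ_diag g i k * germ_diag g k j = 0)"
    by (rule weak_order_equations[OF total[OF i j] total[OF j k] total[OF i k]
          trans[of i j k] trans[of i k j] trans[of j i k] trans[of j k i] trans[of k i j] trans[of k j i]
          same[OF _ _ i j] same[OF _ _ j k] same[OF _ _ i k] root[OF i] root[OF j] root[OF k]
          diag[OF i j] diag[OF j i] diag[OF j k] diag[OF k j] diag[OF i k] swap[OF i j] swap[OF j k]])
  then show ?thesis
    using swap0[OF i j] swap0[OF j k] unfolding braid_coeffs_def mult_eq_0_iff by blast
qed

text \<open>When the vertices do not share one nation, every term vanishes unless \<open>i\<close>
  and \<open>k\<close> are together and \<open>j\<close> is apart. Then the first identity asks the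
  two swap products to agree, and both are the square of the same \<mu>.\<close>

lemma germ_braid_coeffs: "braid_coeffs (germ_diag g) (germ_swap g) i j k"
proof -
  have apart: "germ_diag g x y = 0" if "nation_of (config g) x \<noteq> nation_of (config g) y" for x y
    using that by (simp add: germ_diag_def Let_def)
  show ?thesis
  proof (cases "nation_of (config g) i = nation_of (config g) j")
    case ij: True
    show ?thesis
    proof (cases "nation_of (config g) j = nation_of (config g) k")
      case True
      with ij show ?thesis
        by (intro germ_braid_coeffs_same_nation) simp_all
    next
      case False
      with ij show ?thesis
        by (simp add: braid_coeffs_def apart[of i k] apart[of j k] apart[of k j])
    qed
  next
    case ij: False
    show ?thesis
    proof (cases "nation_of (config g) i = nation_of (config g) k")
      case True
      have "germ_swap g i j * germ_swap g j i = germ_swap g j k * germ_swap g k j"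
        using ij True germ_mu(2)[of i j] by (auto simp: germ_swap_prod)
      then show ?thesis
        using ij True apart[of i j] apart[of j i] apart[of j k] apart[of k j]
        by (simp add: braid_coeffs_def)
    next
      case False
      with ij show ?thesis
        by (simp add: braid_coeffs_def apart[of i j] apart[of i k])
    qed
  qed
qed

lemma charge_conserving_recipe: "charge_conserving (recipe g)"
  unfolding recipe_def by (rule charge_conserving_cc_operator)

lemma cc_braid_rep_recipe: "cc_braid_rep (recipe g)"
  using cc_braid_rep_exchange_iff[of "germ_swap g" "germ_diag g"]
    charge_conserving_recipe[unfolded recipe_eq_exchange] germ_invertible germ_braid_coeffs
  unfolding recipe_eq_exchange by simp

end

section \<open>Every braid representation arises from a germ\<close>

text \<open>The hypothesis makes \<open>f\<close> the class map of an equivalence relation; it is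
  applied to \<open>nation\<close> and \<open>county\<close>.\<close>

lemma partition_on_range_class:
  assumes "\<And>i j. j \<in> f i \<longleftrightarrow> f i = f j"
  shows "partition_on UNIV (range f)"
proof (rule partition_onI)
  show "\<Union> (range f) = UNIV"
    using assms by auto
  show "{} \<notin> range f"
    using assms by (metis empty_iff imageE)
  show "disjnt X Y" if "X \<in> range f" "Y \<in> range f" "X \<noteq> Y" for X Y
    using assms that by (auto simp: disjnt_def)
qed

text \<open>One of the halves may be empty, and a partition has no empty part.\<close>

lemma partition_on_split: "partition_on A ({{x \<in> A. Q x}, {x \<in> A. \<not> Q x}} - {{}})"
  by (auto simp: partition_on_def disjoint_def)

lemma split_class_iff:
  "(\<exists>B\<in>{X, Y} - {{}}. x \<in> B \<and> y \<in> B) \<longleftrightarrow> x \<in> X \<and> y \<in> X \<or> x \<in> Y \<and> y \<in> Y"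
  by blast

lemma card_split_le: "card ({X, Y} - {{}}) \<le> 2"
proof -
  have "card ({X, Y} - {{}}) \<le> card {X, Y}"
    by (intro card_mono) auto
  also have "\<dots> \<le> 2"
    by (simp add: card_insert_if)
  finally show ?thesis .
qed

section \<open>The order structure of a solution\<close>

locale braid_solution =
  fixes p s :: "'n::{finite, linorder} \<Rightarrow> 'n \<Rightarrow> complex"
  assumes swap_same: "s i i = 0"
    and nondegenerate: "p i j * p j i \<noteq> s i j * s j i"
    and braid: "braid_coeffs p s i j k"
begin

lemma
  shows braid1: "(p i j)\<^sup>2 * p j k + s i j * s j i * p i k = p i j * (p j k)\<^sup>2 + s j k * s k j * p i k"
    and braid2: "s i j \<noteq> 0 \<Longrightarrow> p i j * p j k + p i k * p j i = p j k * p i k"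
    and braid3: "s j k \<noteq> 0 \<Longrightarrow> p i j * p i k = p i j * p j k + p i k * p k j"
  using braid[of i j k] by (auto simp: braid_coeffs_def diff_eq_eq add.commute)

lemma diag_nonzero: "p i i \<noteq> 0"
  using nondegenerate[of i i] swap_same[of i] by auto

text \<open>On the triple \<open>i, i, j\<close> the third identity reduces to
  \<open>s i j * p i j * p j i = 0\<close>. Conversely, if \<open>s i j = 0\<close> then
  nondegeneracy makes both coefficients nonzero.\<close>

lemma swap_eq_0_iff: "s i j = 0 \<longleftrightarrow> p i j \<noteq> 0 \<and> p j i \<noteq> 0"
  using braid3[of i j i] nondegenerate[of i j] by auto

text \<open>The first identity on the triples \<open>i, i, j\<close> and \<open>i, j, j\<close>
  makes \<open>p i i\<close> and \<open>p j j\<close> roots of the same quadratic X^2 -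
  \<open>p i j\<close> X - \<open>s i j * s j i\<close>.\<close>

lemma root:
  assumes "p i j \<noteq> 0"
  shows "s i j * s j i = (p i i)\<^sup>2 - p i i * p i j" "s i j * s j i = (p j j)\<^sup>2 - p j j * p i j"
proof -
  have "p i j * (s i j * s j i) = p i j * ((p i i)\<^sup>2 - p i i * p i j)"
    using braid1[of i i j] by (simp add: swap_same algebra_simps power2_eq_square)
  then show "s i j * s j i = (p i i)\<^sup>2 - p i i * p i j"
    using assms by simp
  have "p i j * (s i j * s j i) = p i j * ((p j j)\<^sup>2 - p j j * p i j)"
    using braid1[of i j j] by (simp add: swap_same algebra_simps power2_eq_square)
  then show "s i j * s j i = (p j j)\<^sup>2 - p j j * p i j"
    using assms by simp
qed

text \<open>Here \<open>s i j = 0\<close>, so the quadratic in \<open>root\<close> is X (X -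
  \<open>p i j\<close>), and the diagonal coefficients are its nonzero root.\<close>

lemma same_county_coeffs:
  assumes "p i j \<noteq> 0" "p j i \<noteq> 0"
  shows "p i j = p i i" "p j j = p i i"
proof -
  have "s i j = 0"
    using assms by (simp add: swap_eq_0_iff)
  then have "p i i * (p i i - p i j) = 0" "p j j * (p j j - p i j) = 0"
    using root[OF assms(1)] by (auto simp: algebra_simps power2_eq_square)
  then show "p i j = p i i" "p j j = p i i"
    using diag_nonzero by auto
qed

text \<open>If \<open>p i k = 0\<close>, the second and third identities force \<open>p j i\<close>
  and \<open>p k j\<close> to be nonzero as well, so \<open>j\<close> shares its diagonal
  coefficient with both \<open>i\<close> and \<open>k\<close>. The quadratic at \<open>k, i\<close>
  then gives a zero swap product, although \<open>s i k\<close> and \<open>s k i\<close> are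
  nonzero.\<close>

lemma precedes_trans:
  assumes "p i j \<noteq> 0" "p j k \<noteq> 0"
  shows "p i k \<noteq> 0"
proof
  assume ik: "p i k = 0"
  then have s: "s i k \<noteq> 0" "s k i \<noteq> 0"
    by (simp_all add: swap_eq_0_iff)
  have ji: "p j i \<noteq> 0"
    using braid2[of i j k] ik assms swap_eq_0_iff[of i j] by auto
  have kj: "p k j \<noteq> 0"
    using braid3[of j k i] ik assms swap_eq_0_iff[of j k] by auto
  have "p k i = p j i"
    using braid3[OF s(1), of j] ik assms by simp
  moreover have "p k k = p j i"
    using same_county_coeffs(1)[OF ji assms(1)] same_county_coeffs(2)[OF assms(2) kj] by simp
  ultimately have "s k i * s i k = 0"
    using root(1)[of k i] ji by (simp add: power2_eq_square)
  then show False
    using s by simp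
qed

definition comparable :: "'n \<Rightarrow> 'n \<Rightarrow> bool" where
  "comparable i j \<longleftrightarrow> p i j \<noteq> 0 \<or> p j i \<noteq> 0"

lemma comparable_refl: "comparable i i"
  by (simp add: comparable_def diag_nonzero)

lemma comparable_sym: "comparable i j \<longleftrightarrow> comparable j i"
  by (auto simp: comparable_def)

text \<open>For incomparable \<open>i\<close> and \<open>k\<close> the swap \<open>s i k\<close> is
  nonzero and the second identity collapses to \<open>p k j * p i j = 0\<close>. Together with its
  dual for a common lower vertex, this turns comparability into an equivalence relation.\<close>

lemma comparable_below:
  assumes "p i j \<noteq> 0" "p k j \<noteq> 0"
  shows "comparable i k"
  using braid2[of i k j] assms swap_eq_0_iff[of i k] by (auto simp: comparable_def)

lemma comparable_above:
  assumes "p j i \<noteq> 0" "p j k \<noteq> 0"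
  shows "comparable i k"
  using braid3[of i k j] assms swap_eq_0_iff[of i k] by (auto simp: comparable_def)

lemma comparable_trans:
  assumes "comparable i j" "comparable j k"
  shows "comparable i k"
  using assms precedes_trans[of i j k] precedes_trans[of k j i]
    comparable_below[of i j k] comparable_above[of j i k]
  unfolding comparable_def by blast

text \<open>Since \<open>j\<close> and \<open>k\<close> are comparable, one of \<open>p j k\<close>,
  \<open>p k j\<close> is nonzero and can be cancelled from the second identity, where
  \<open>p j i = 0\<close> or \<open>p k i = 0\<close> removes the middle term.\<close>

lemma strict_const_left:
  assumes "p i j \<noteq> 0" "p j i = 0" "p i k \<noteq> 0" "p k i = 0"
  shows "p i j = p i k"
proof -
  have s: "s i j \<noteq> 0" "s i k \<noteq> 0"
    using assms by (simp_all add: swap_eq_0_iff)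
  have "p j k \<noteq> 0 \<or> p k j \<noteq> 0"
    using comparable_above[OF assms(1,3)] by (simp add: comparable_def)
  then show ?thesis
    using braid2[OF s(1), of k] braid2[OF s(2), of j] assms by auto
qed

lemma strict_const_right:
  assumes "p i k \<noteq> 0" "p k i = 0" "p j k \<noteq> 0" "p k j = 0"
  shows "p i k = p j k"
proof -
  have s: "s i k \<noteq> 0" "s j k \<noteq> 0"
    using assms by (simp_all add: swap_eq_0_iff)
  have "p i j \<noteq> 0 \<or> p j i \<noteq> 0"
    using comparable_below[OF assms(1,3)] by (simp add: comparable_def)
  then show ?thesis
    using braid3[OF s(1), of j] braid3[OF s(2), of i] assms by auto
qed

text \<open>By symmetry let \<open>p i k \<noteq> 0\<close>. Then \<open>i\<close> strictly precedes
  \<open>l\<close>, and the pair \<open>i, l\<close> shares its left end with \<open>i, j\<close>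
  and its right end with \<open>k, l\<close>.\<close>

lemma strict_const:
  assumes "p i j \<noteq> 0" "p j i = 0" "p k l \<noteq> 0" "p l k = 0" "comparable i k"
  shows "p i j = p k l"
proof -
  have *: "p i j = p k l"
    if "p i j \<noteq> 0" "p j i = 0" "p k l \<noteq> 0" "p l k = 0" "p i k \<noteq> 0" for i j k l
  proof -
    have "p i l \<noteq> 0" "p l i = 0"
      using that precedes_trans[of i k l] precedes_trans[of l i k] by auto
    then show ?thesis
      using strict_const_left[of i j l] strict_const_right[of i l k] that by simp
  qed
  show ?thesis
    using assms *[of i j k l] *[of k l i j] by (auto simp: comparable_def)
qed

text \<open>One end moves at a time: with \<open>j\<close> outside the nation of \<open>i\<close>
  and \<open>i'\<close>, the first identity on \<open>i, j, i'\<close> or on \<open>i', j, i\<close>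
  keeps only the swap products, multiplied by a nonzero coefficient.\<close>

lemma swap_prod_const:
  assumes "comparable i i'" "comparable j j'" "\<not> comparable i j"
  shows "s i j * s j i = s i' j' * s j' i'"
proof -
  have *: "s i j * s j i = s i' j * s j i'" if "comparable i i'" "\<not> comparable i j" for i i' j
  proof -
    have "\<not> comparable i' j"
      using that comparable_trans by blast
    then show ?thesis
      using that braid1[of i j i'] braid1[of i' j i] by (auto simp: comparable_def mult.commute)
  qed
  have "\<not> comparable j i'"
    using assms comparable_trans comparable_sym by blast
  then show ?thesis
    using *[OF assms(1,3)] *[OF assms(2)] by (simp add: mult.commute)
qed

section \<open>The germ read off from a solution\<close>

definition nation :: "'n \<Rightarrow> 'n set" where
  "nation i = {j. comparable i j}"

definition county :: "'n \<Rightarrow> 'n set" where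
  "county i = {j. p i j \<noteq> 0 \<and> p j i \<noteq> 0}"

text \<open>A representative of the first county; its diagonal coefficient decides which root is
  called \<alpha>.\<close>

definition least_vertex :: "'n set \<Rightarrow> 'n" where
  "least_vertex n = (SOME f. f \<in> n \<and> (\<forall>j\<in>n. p f j \<noteq> 0))"

definition nation_alpha :: "'n set \<Rightarrow> complex" where
  "nation_alpha n = p (least_vertex n) (least_vertex n)"

text \<open>The chosen value is \<alpha> + \<beta>, by \<open>strict_const\<close> the same for
  every strictly ordered pair. A nation with one county has no such pair, and its \<beta> is
  arbitrary.\<close>

definition nation_beta :: "'n set \<Rightarrow> complex" where
  "nation_beta n = (SOME q. \<exists>i\<in>n. \<exists>j\<in>n. p i j \<noteq> 0 \<and> p j i = 0 \<and> q = p i j) - nation_alpha n"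

text \<open>The product under the root is symmetric in the two nations, so the same branch is taken
  for both orders and \<mu> is symmetric.\<close>

definition nation_mu :: "'n set \<Rightarrow> 'n set \<Rightarrow> complex" where
  "nation_mu n n' = csqrt (s (SOME i. i \<in> n) (SOME j. j \<in> n') * s (SOME j. j \<in> n') (SOME i. i \<in> n))"

text \<open>The preorder on vertices descends to an order on counties, and the split separates
  diagonal coefficient \<alpha> from the other root; if the roots coincide there is one
  part.\<close>

definition solution_config :: "'n configuration" where
  "solution_config = \<lparr>nations = range nation, counties = range county,
     county_order = \<lambda>n. {(county i, county j) | i j. i \<in> n \<and> j \<in> n \<and> p i j \<noteq> 0},
     county_split = \<lambda>n. {{c \<in> county ` n. \<forall>i\<in>c. p i i = nation_alpha n},
                         {c \<in> county ` n. \<not> (\<forall>i\<in>c. p i i = nation_alpha n)}} - {{}}\<rparr>"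

definition solution_germ :: "'n germ" where
  "solution_germ = \<lparr>config = solution_config, alpha = nation_alpha, beta = nation_beta, mu = nation_mu\<rparr>"

lemma nation_eq_iff: "nation i = nation j \<longleftrightarrow> comparable i j"
  unfolding nation_def using comparable_refl comparable_sym comparable_trans by blast

lemma county_eq_iff: "county i = county j \<longleftrightarrow> p i j \<noteq> 0 \<and> p j i \<noteq> 0"
  unfolding county_def using diag_nonzero precedes_trans by blast

lemma in_nation: "i \<in> nation i" and in_county: "i \<in> county i"
  by (simp_all add: nation_def county_def comparable_refl diag_nonzero)

lemma in_nation_iff: "j \<in> nation i \<longleftrightarrow> nation i = nation j"
  by (simp add: nation_eq_iff) (simp add: nation_def)

lemma in_county_iff: "j \<in> county i \<longleftrightarrow> county i = county j"
  by (simp add: county_eq_iff) (simp add: county_def)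

lemma comparable_in_nation: "i \<in> nation k \<Longrightarrow> j \<in> nation k \<Longrightarrow> comparable i j"
  unfolding in_nation_iff nation_eq_iff[symmetric] by simp

lemma county_subset_nation_iff: "county j \<subseteq> nation i \<longleftrightarrow> j \<in> nation i"
proof
  show "county j \<subseteq> nation i \<Longrightarrow> j \<in> nation i"
    using in_county by blast
  show "county j \<subseteq> nation i" if "j \<in> nation i"
    using that unfolding in_nation_iff by (auto simp: county_def nation_def comparable_def)
qed

lemma counties_in_solution: "counties_in solution_config (nation i) = county ` nation i"
  unfolding counties_in_def solution_config_def configuration.simps
  using county_subset_nation_iff[of _ i] by blast

lemma county_cong:
  assumes "county i = county i'" "county j = county j'"
  shows "p i j \<noteq> 0 \<longleftrightarrow> p i' j' \<noteq> 0"
  using assms precedes_trans unfolding county_eq_iff by blast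

lemma county_order_solution_iff:
  "(county i, county j) \<in> county_order solution_config (nation k) \<longleftrightarrow>
     i \<in> nation k \<and> j \<in> nation k \<and> p i j \<noteq> 0"
proof
  assume "(county i, county j) \<in> county_order solution_config (nation k)"
  then obtain i' j' where eq: "county i = county i'" "county j = county j'"
    and "i' \<in> nation k" "j' \<in> nation k" "p i' j' \<noteq> 0"
    by (auto simp: solution_config_def)
  moreover have "i \<in> nation k \<longleftrightarrow> i' \<in> nation k" "j \<in> nation k \<longleftrightarrow> j' \<in> nation k"
    using eq by (metis county_subset_nation_iff)+
  ultimately show "i \<in> nation k \<and> j \<in> nation k \<and> p i j \<noteq> 0"
    using county_cong[OF eq] by blast
qed (auto simp: solution_config_def)

lemma solution_config: "solution_config \<in> configurations"
proof -
  have "partition_on UNIV (nations solution_config)" "partition_on UNIV (counties solution_config)"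
    by (simp_all add: solution_config_def partition_on_range_class in_nation_iff in_county_iff)
  moreover have "\<exists>Y\<in>nations solution_config. X \<subseteq> Y" if X: "X \<in> counties solution_config" for X
  proof -
    obtain i where "X = county i"
      using X by (auto simp: solution_config_def)
    then have "X \<subseteq> nation i"
      by (simp add: county_subset_nation_iff in_nation)
    then show ?thesis
      by (auto simp: solution_config_def)
  qed
  moreover have "linear_order_on (counties_in solution_config n) (county_order solution_config n)
      \<and> partition_on (counties_in solution_config n) (county_split solution_config n)
      \<and> card (county_split solution_config n) \<le> 2"
    if n_nation: "n \<in> nations solution_config" for n
  proof -
    obtain k where n: "n = nation k"
      using n_nation by (auto simp: solution_config_def)
    let ?r = "county_order solution_config n"
    have sub: "?r \<subseteq> county ` n \<times> county ` n"
      by (auto simp: solution_config_def)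
    have iff: "(county i, county j) \<in> ?r \<longleftrightarrow> i \<in> n \<and> j \<in> n \<and> p i j \<noteq> 0" for i j
      unfolding n by (rule county_order_solution_iff)
    have "refl_on (county ` n) ?r"
      by (auto simp: refl_on_def iff diag_nonzero)
    moreover have "trans ?r"
    proof (rule transI)
      fix x y z
      assume xy: "(x, y) \<in> ?r" and yz: "(y, z) \<in> ?r"
      obtain i j k where "x = county i" "y = county j" "z = county k"
        using xy yz sub by blast
      then show "(x, z) \<in> ?r"
        using xy yz precedes_trans[of i j k] by (simp add: iff)
    qed
    moreover have "antisym ?r"
    proof (rule antisymI)
      fix x y
      assume xy: "(x, y) \<in> ?r" and yx: "(y, x) \<in> ?r"
      obtain i j where "x = county i" "y = county j"
        using xy sub by blast
      then show "x = y"
        using xy yx by (simp add: iff county_eq_iff)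
    qed
    moreover have "total_on (county ` n) ?r"
      using comparable_in_nation[of _ k, folded n]
      by (auto simp: total_on_def iff comparable_def)
    ultimately have "linear_order_on (county ` n) ?r"
      using sub unfolding order_on_defs by simp
    moreover have "partition_on (county ` n) (county_split solution_config n)"
      unfolding solution_config_def configuration.simps by (rule partition_on_split)
    moreover have "card (county_split solution_config n) \<le> 2"
      unfolding solution_config_def configuration.simps by (rule card_split_le)
    ultimately show ?thesis
      using counties_in_solution[of k] by (simp add: n)
  qed
  ultimately show ?thesis
    by (simp add: configurations_def refines_def)
qed

lemma nation_of_solution: "nation_of solution_config i = nation i"
  using nation_of_eqI[OF solution_config _ in_nation] by (simp add: solution_config_def)

lemma county_of_solution: "county_of solution_config i = county i"
  using county_of_eqI[OF solution_config _ in_county] by (simp add: solution_config_def)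

lemma least_vertex:
  "least_vertex (nation k) \<in> nation k"
  "j \<in> nation k \<Longrightarrow> p (least_vertex (nation k)) j \<noteq> 0"
proof -
  have "finite (nation k)" "nation k \<noteq> {}"
    using in_nation by auto
  then obtain f where "f \<in> nation k" "\<And>j. j \<in> nation k \<Longrightarrow> p f j \<noteq> 0"
  proof (rule finite_total_preorder_least[where r = "\<lambda>i j. p i j \<noteq> 0"])
    show "p i j \<noteq> 0 \<or> p j i \<noteq> 0" if "i \<in> nation k" "j \<in> nation k" for i j
      using comparable_in_nation[OF that] by (simp add: comparable_def)
    show "p i l \<noteq> 0" if "p i j \<noteq> 0" "p j l \<noteq> 0" for i j l
      using that by (rule precedes_trans)
  qed blast
  then have "\<exists>f. f \<in> nation k \<and> (\<forall>j\<in>nation k. p f j \<noteq> 0)"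
    by blast
  from someI_ex[OF this] show "least_vertex (nation k) \<in> nation k"
    "j \<in> nation k \<Longrightarrow> p (least_vertex (nation k)) j \<noteq> 0"
    by (simp_all add: least_vertex_def)
qed

lemma first_county_solution: "first_county solution_config (nation k) = county (least_vertex (nation k))"
proof (rule first_county_eqI[OF solution_config])
  show "nation k \<in> nations solution_config"
    by (simp add: solution_config_def)
  show "county (least_vertex (nation k)) \<in> counties_in solution_config (nation k)"
    using least_vertex(1) by (simp add: counties_in_solution)
  show "(county (least_vertex (nation k)), d) \<in> county_order solution_config (nation k)"
    if "d \<in> counties_in solution_config (nation k)" for d
    using that least_vertex by (auto simp: counties_in_solution county_order_solution_iff)
qed

lemma nation_alpha_beta:
  assumes "i \<in> nation k" "j \<in> nation k" "p i j \<noteq> 0" "p j i = 0"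
  shows "nation_alpha (nation k) + nation_beta (nation k) = p i j"
proof -
  let ?P = "\<lambda>q. \<exists>i\<in>nation k. \<exists>j\<in>nation k. p i j \<noteq> 0 \<and> p j i = 0 \<and> q = p i j"
  have "?P (p i j)"
    using assms by blast
  then have "?P (SOME q. ?P q)"
    by (rule someI)
  then obtain i' j' where "i' \<in> nation k" "p i' j' \<noteq> 0" "p j' i' = 0" "(SOME q. ?P q) = p i' j'"
    by blast
  moreover from this have "p i' j' = p i j"
    using assms by (intro strict_const comparable_in_nation)
  ultimately show ?thesis
    by (simp add: nation_beta_def)
qed

text \<open>At the least vertex the left side is \<alpha>^2 - \<alpha> (\<alpha> + \<beta>). A
  vertex strictly above it is a root of the same quadratic by \<open>root\<close>, and a vertex of
  its county has the same diagonal coefficient.\<close>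

lemma diag_characteristic:
  assumes "i \<in> nation k" "j \<in> nation k" "p i j \<noteq> 0" "p j i = 0" "l \<in> nation k"
  shows "(p l l)\<^sup>2 - p l l * p i j = - (nation_alpha (nation k) * nation_beta (nation k))"
proof -
  let ?f = "least_vertex (nation k)"
  have "(p l l)\<^sup>2 - p l l * p i j = (p ?f ?f)\<^sup>2 - p ?f ?f * p i j"
  proof (cases "p l ?f = 0")
    case True
    have fl: "p ?f l \<noteq> 0"
      using least_vertex(2) assms by blast
    have "comparable ?f i"
      using least_vertex(1) assms(1) by (rule comparable_in_nation)
    then have "p ?f l = p i j"
      using True fl assms by (intro strict_const)
    then show ?thesis
      using root[OF fl] by simp
  next
    case False
    then have "p l l = p ?f ?f"
      using same_county_coeffs(2)[of l ?f] least_vertex(2) assms by simp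
    then show ?thesis
      by simp
  qed
  then show ?thesis
    using nation_alpha_beta[OF assms(1-4)]
    by (simp add: nation_alpha_def algebra_simps power2_eq_square flip: nation_alpha_beta[OF assms(1-4)])
qed

lemma swap_prod_nation:
  assumes "comparable i j" "county i \<noteq> county j"
  shows "s i j * s j i = - (nation_alpha (nation i) * nation_beta (nation i))"
proof -
  have j: "j \<in> nation i"
    using assms(1) by (simp add: nation_def)
  consider "p i j \<noteq> 0" "p j i = 0" | "p j i \<noteq> 0" "p i j = 0"
    using assms by (auto simp: county_eq_iff comparable_def)
  then show ?thesis
  proof cases
    case 1
    then show ?thesis
      using root(1)[of i j] diag_characteristic[OF in_nation j 1 in_nation] by simp
  next
    case 2
    then show ?thesis
      using root(2)[of j i] diag_characteristic[OF j in_nation 2 in_nation] by (simp add: mult.commute)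
  qed
qed

text \<open>The quadratic factors when \<open>i\<close> lies strictly above the least vertex.
  Otherwise \<open>i\<close> is in the first county and has \<alpha>, which also covers nations with
  an arbitrary \<beta>.\<close>

lemma diag_disj:
  "p i i = nation_alpha (nation i) \<or> p i i = nation_beta (nation i)"
proof -
  let ?f = "least_vertex (nation i)"
  have f: "?f \<in> nation i" "p ?f i \<noteq> 0"
    using least_vertex in_nation by blast+
  show ?thesis
  proof (cases "p i ?f = 0")
    case True
    have "(p i i - nation_alpha (nation i)) * (p i i - nation_beta (nation i)) = 0"
      using diag_characteristic[OF f(1) in_nation f(2) True in_nation]
        nation_alpha_beta[OF f(1) in_nation f(2) True, symmetric]
      by (simp add: algebra_simps power2_eq_square)
    then show ?thesis
      by simp
  next
    case False
    then show ?thesis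
      using same_county_coeffs(2)[OF f(2)] by (simp add: nation_alpha_def)
  qed
qed

lemma nation_mu_eq:
  assumes "\<not> comparable i j"
  shows "(nation_mu (nation i) (nation j))\<^sup>2 = s i j * s j i"
    and "nation_mu (nation i) (nation j) = nation_mu (nation j) (nation i)"
proof -
  have "comparable k (SOME i. i \<in> nation k)" for k
    using someI[of "\<lambda>i. i \<in> nation k", OF in_nation] by (simp add: nation_def)
  from swap_prod_const[OF this this assms]
  show "(nation_mu (nation i) (nation j))\<^sup>2 = s i j * s j i"
    by (simp add: nation_mu_def)
  show "nation_mu (nation i) (nation j) = nation_mu (nation j) (nation i)"
    by (simp add: nation_mu_def mult.commute)
qed

lemma solution_germ: "solution_germ \<in> germs"
proof -
  have "nation_alpha (nation k) \<noteq> 0" for k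
    by (simp add: nation_alpha_def diag_nonzero)
  moreover have "nation_beta (nation k) \<noteq> 0 \<and> nation_alpha (nation k) + nation_beta (nation k) \<noteq> 0"
    if "card (counties_in solution_config (nation k)) > 1" for k
  proof -
    have "\<exists>x\<in>county ` nation k. \<exists>y\<in>county ` nation k. x \<noteq> y"
      using that unfolding counties_in_solution
      by (metis One_nat_def card_le_Suc0_iff_eq finite not_less)
    then obtain i j where ij: "i \<in> nation k" "j \<in> nation k" "county i \<noteq> county j"
      by blast
    then have "comparable i j"
      by (intro comparable_in_nation)
    \<comment> \<open>This product is nonzero between different counties, which gives \<beta>
      nonzero; \<alpha> + \<beta> is nonzero as the value of \<open>p\<close> on a strict
      pair.\<close>
    then have "s i j * s j i = - (nation_alpha (nation k) * nation_beta (nation k))"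
      using swap_prod_nation[of i j] ij by (simp add: in_nation_iff)
    moreover have "s i j * s j i \<noteq> 0"
      using ij(3) swap_eq_0_iff[of i j] swap_eq_0_iff[of j i] by (auto simp: county_eq_iff)
    moreover have "nation_alpha (nation k) + nation_beta (nation k) \<noteq> 0"
      using \<open>comparable i j\<close> ij nation_alpha_beta[of i k j] nation_alpha_beta[of j k i]
      by (auto simp: comparable_def county_eq_iff)
    ultimately show ?thesis
      by simp
  qed
  moreover have "nation_mu (nation i) (nation j) \<noteq> 0 \<and>
      nation_mu (nation i) (nation j) = nation_mu (nation j) (nation i)"
    if "nation i \<noteq> nation j" for i j
  proof -
    have n: "\<not> comparable i j"
      using that by (simp add: nation_eq_iff)
    then have "s i j * s j i \<noteq> 0"
      using swap_eq_0_iff[of i j] swap_eq_0_iff[of j i] by (auto simp: comparable_def)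
    then show ?thesis
      using nation_mu_eq[OF n] by auto
  qed
  moreover have "nations solution_config = range nation"
    by (simp add: solution_config_def)
  ultimately show ?thesis
    unfolding germs_def solution_germ_def mem_Collect_eq germ.simps
    using solution_config by (simp only: ball_simps) blast
qed

section \<open>Comparison of the solution with its recipe\<close>

lemma vertex_coeff_solution: "vertex_coeff solution_germ i = p i i"
proof -
  let ?n = "nation i"
  let ?f = "least_vertex ?n"
  have county_diag: "(\<forall>l\<in>county j. p l l = nation_alpha ?n) \<longleftrightarrow> p j j = nation_alpha ?n" for j
    using same_county_coeffs(2) in_county unfolding county_def by (metis (mono_tags) mem_Collect_eq)
  have f: "?f \<in> ?n" "p ?f ?f = nation_alpha ?n"
    by (simp_all add: least_vertex nation_alpha_def)
  \<comment> \<open>The first county lies in the \<alpha> half, so sharing its part means having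
    diagonal coefficient \<alpha>.\<close>
  have "(\<exists>B\<in>county_split solution_config ?n. county i \<in> B \<and> county ?f \<in> B) \<longleftrightarrow> p i i = nation_alpha ?n"
    using imageI[OF in_nation[of i], of county] imageI[OF f(1), of county] county_diag f(2)
    unfolding solution_config_def configuration.simps split_class_iff mem_Collect_eq by simp
  then have "vertex_coeff solution_germ i =
      (if p i i = nation_alpha ?n then nation_alpha ?n else nation_beta ?n)"
    unfolding vertex_coeff_def Let_def solution_germ_def germ.simps nation_of_solution
      county_of_solution first_county_solution by (rule if_cong) (rule refl)+
  then show ?thesis
    using diag_disj[of i] by presburger
qed

lemma germ_diag_solution: "germ_diag solution_germ = p"
proof (intro ext)
  fix i j
  have *: "germ_diag solution_germ i j =
    (if nation i \<noteq> nation j then 0 else if county i = county j then p i i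
     else if p i j \<noteq> 0 then nation_alpha (nation i) + nation_beta (nation i) else 0)"
    unfolding germ_diag_def Let_def vertex_coeff_solution
    by (auto simp: solution_germ_def nation_of_solution county_of_solution
        county_order_solution_iff in_nation in_nation_iff)
  show "germ_diag solution_germ i j = p i j"
  proof (cases "comparable i j")
    case False
    then show ?thesis
      unfolding * by (simp add: nation_eq_iff comparable_def)
  next
    case True
    then have "j \<in> nation i"
      by (simp add: nation_def)
    then show ?thesis
      using True nation_alpha_beta[OF in_nation, of j i] same_county_coeffs(1)[of i j]
      unfolding * by (auto simp: nation_eq_iff county_eq_iff)
  qed
qed

text \<open>The recipe reproduces \<open>p\<close> exactly, so only the swaps need rescaling; their
  products agree by the choice of \<mu>, \<alpha> and \<beta>.\<close>

lemma X_equivalent_recipe_solution: "X_equivalent (exchange p s) (recipe solution_germ)"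
proof -
  have config: "config solution_germ = solution_config"
    by (simp add: solution_germ_def)
  have "X_equivalent (exchange p s) (exchange p (germ_swap solution_germ))"
  proof (rule X_equivalent_exchange)
    fix i j
    show "s i i = 0"
      by (rule swap_same)
    show "germ_swap solution_germ i i = 0"
      by simp
    show "s i j = 0 \<longleftrightarrow> s j i = 0"
      using swap_eq_0_iff[of i j] swap_eq_0_iff[of j i] by auto
    show "s i j = 0 \<longleftrightarrow> germ_swap solution_germ i j = 0"
      by (simp add: germ_swap_eq_0_iff[OF solution_germ] config county_of_solution county_eq_iff
          swap_eq_0_iff)
    have "germ_swap solution_germ i j * germ_swap solution_germ j i =
        (if nation i \<noteq> nation j then (nation_mu (nation i) (nation j))\<^sup>2
         else if county i = county j then 0
         else - (nation_alpha (nation i) * nation_beta (nation i)))"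
      unfolding germ_swap_prod[OF solution_germ] config nation_of_solution county_of_solution
      by (simp add: solution_germ_def)
    also have "\<dots> = s i j * s j i"
      using nation_mu_eq(1)[of i j] swap_prod_nation[of i j] swap_eq_0_iff[of i j]
      by (auto simp: nation_eq_iff county_eq_iff)
    finally show "germ_swap solution_germ i j * germ_swap solution_germ j i = s i j * s j i" .
  qed
  then show ?thesis
    by (simp add: recipe_eq_exchange[OF solution_germ] germ_diag_solution)
qed

end

theorem theorem4p12:
  shows "(\<forall>g \<in> (germs :: 'n::{finite, linorder} germ set). cc_braid_rep (recipe g)) \<and>
         (\<forall>R :: 'n operator. cc_braid_rep R \<longrightarrow> (\<exists>g \<in> germs. X_equivalent R (recipe g)))"
proof (intro conjI ballI allI impI)
  show "cc_braid_rep (recipe g)" if "g \<in> germs" for g :: "'n germ"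
    using that by (rule cc_braid_rep_recipe)
next
  fix R :: "'n operator"
  assume R: "cc_braid_rep R"
  then have "charge_conserving R"
    by (simp add: cc_braid_rep_def)
  then obtain p s where ps: "R = exchange p s" "\<And>i. s i i = 0"
    by (rule charge_conserving_imp_exchange) blast
  have "(\<forall>i j. p i j * p j i \<noteq> s i j * s j i) \<and> (\<forall>i j k. braid_coeffs p s i j k)"
    using R cc_braid_rep_exchange_iff[of s p] \<open>charge_conserving R\<close> ps by simp
  then have "braid_solution p s"
    using ps(2) by unfold_locales blast+
  then interpret braid_solution p s .
  show "\<exists>g\<in>germs. X_equivalent R (recipe g)"
    using solution_germ X_equivalent_recipe_solution ps(1) by blast
qed

end
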